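(* Let $(\alpha,\beta)$ be a Bertrand curve pair in $\mathbb{R}^3$, $\beta=\alpha+\lambda N$, where $\alpha$ has Frenet frame $T,N,B$, curvature $\kappa$ and torsion $\tau$, and let $\theta$ be the angle with $T_\beta=\cos\theta\,T+\sin\theta\,B$. Then, with respect to the connection $D$, the following hold. 1) The partner curve $\beta$ is biharmonic if and only if $$(3\lambda\kappa-\sin^2\theta)\kappa'=0,$$ $$(\lambda\kappa-\sin^2\theta)(1-\cos\theta)^2(\kappa^2+\tau^2)-\lambda\kappa''\sin^2\theta=0,$$ $$\sin^2\theta\,\tau'-\lambda\kappa\tau'-2\lambda\kappa'\tau=0.$$ 2) The partner curve $\beta$ is of 1-type harmonic if and only if there is a constant $c\in\mathbb{R}$ such that $$(3\lambda\kappa-\sin^2\theta)\kappa'=0,$$ $$\frac{(\lambda\kappa-\sin^2\theta)(1-\cos\theta)^2(\kappa^2+\tau^2)-\lambda\kappa''\sin^2\theta}{\sin^2\theta}=c\,(\lambda\kappa-\sin^2\theta),$$ $$\sin^2\theta\,\tau'-\lambda\kappa\tau'-2\lambda\kappa'\tau=0.$$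
   Context: Setting. $\alpha:I\to\mathbb{R}^3$ is a smooth unit speed curve with arc-length parameter $s$, Frenet frame $T,N,B$, curvature $\kappa>0$ and torsion $\tau>0$, with $T'=\kappa N$, $N'=-\kappa T+\tau B$, $B'=-\tau N$. A prime denotes $d/ds$. A Bertrand curve pair $(\alpha,\beta)$ consists of $\alpha$ and a curve $\beta$ having the same principal normal lines at corresponding points; then $\beta(s)=\alpha(s)+\lambda N(s)$ with $\lambda$ a real constant, and there is a real constant $\mu$ with $\lambda\kappa+\mu\tau=1$. It is assumed that $\lambda\neq0$ and $\mu\neq 0$. Put $\vartheta=\|\beta'(s)\|=\tau\sqrt{\lambda^2+\mu^2}$. The Frenet frame of $\beta$ is $T_\beta=\beta'/\vartheta=\cos\theta\,T+\sin\theta\,B$, $N_\beta=N$, $B_\beta=-\sin\theta\,T+\cos\theta\,B$, where $\theta$ is a constant angle with $\sin\theta\neq0$. The curvature of $\beta$ is $\kappa_\beta=\frac{\lambda\kappa-\sin^2\theta}{\lambda(1-\lambda\kappa)}$. The operator $D_B$. On vector fields along $\alpha$, $D_B$ is the additive operator with $D_B(fX)=f'X+fD_BX$ for smooth functions $f$ of $s$, and $$D_BT=\frac{1-\cos\theta}{\sin\theta}\kappa N,\quad D_BN=-\frac{1-\cos\theta}{\sin\theta}\kappa T+\frac{1-\cos\theta}{\sin\theta}\tau B,\quad D_BB=-\frac{1-\cos\theta}{\sin\theta}\tau N.$$ Harmonicity. The mean curvature vector of $\beta$ is $\mathbb{H}_\beta=\vartheta\kappa_\beta N_\beta=\frac{\lambda\kappa-\sin^2\theta}{\mu\sin\theta}N$,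 and its Laplacian is $\Delta\mathbb{H}_\beta=-D_BD_B\mathbb{H}_\beta$. With respect to $D$, $\beta$ is called biharmonic if $\Delta\mathbb{H}_\beta=0$ identically, and of 1-type harmonic if $\Delta\mathbb{H}_\beta=c\,\mathbb{H}_\beta$ for some constant $c\in\mathbb{R}$. *)

theory Defs
  imports "HOL-Analysis.Analysis"
begin

(* Derivatives are taken within the parameter interval I, so that I may be open, closed or
   half-open; at interior points of I they are the ordinary derivatives. *)
definition ddt :: "real set \<Rightarrow> (real \<Rightarrow> 'a::real_normed_vector) \<Rightarrow> real \<Rightarrow> 'a" where
  "ddt I f = (\<lambda>s. vector_derivative f (at s within I))"

definition smooth_on :: "real set \<Rightarrow> (real \<Rightarrow> 'a::real_normed_vector) \<Rightarrow> bool" where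
  "smooth_on I f \<longleftrightarrow> (\<forall>n. \<forall>s\<in>I. (ddt I ^^ n) f differentiable (at s within I))"

(* A regular curve g of speed v with a positively oriented orthonormal frame satisfying the
   Frenet equations d/ds = v d/d(arc length).  The curvature k is signed relative to the chosen
   principal normal N, as is needed for the partner of a Bertrand curve, whose frame shares N. *)
definition frenet_curve ::
  "real set \<Rightarrow> (real \<Rightarrow> real^3) \<Rightarrow> (real \<Rightarrow> real) \<Rightarrow> (real \<Rightarrow> real^3) \<Rightarrow> (real \<Rightarrow> real^3)
    \<Rightarrow> (real \<Rightarrow> real^3) \<Rightarrow> (real \<Rightarrow> real) \<Rightarrow> (real \<Rightarrow> real) \<Rightarrow> bool" where
  "frenet_curve I g v T N B k t \<longleftrightarrow>
     smooth_on I g \<and> smooth_on I v \<and> smooth_on I T \<and> smooth_on I N \<and> smooth_on I B \<and>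
     smooth_on I k \<and> smooth_on I t \<and>
     (\<forall>s\<in>I. v s > 0 \<and> ddt I g s = v s *\<^sub>R T s \<and>
        norm (T s) = 1 \<and> norm (N s) = 1 \<and> T s \<bullet> N s = 0 \<and> B s = cross3 (T s) (N s) \<and>
        ddt I T s = (v s * k s) *\<^sub>R N s \<and>
        ddt I N s = v s *\<^sub>R (- k s *\<^sub>R T s + t s *\<^sub>R B s) \<and>
        ddt I B s = - (v s * t s) *\<^sub>R N s)"

definition normal_line :: "real^3 \<Rightarrow> real^3 \<Rightarrow> (real^3) set" where
  "normal_line p n = range (\<lambda>r. p + r *\<^sub>R n)"

definition bertrand_pair ::
  "real set \<Rightarrow> (real \<Rightarrow> real^3) \<Rightarrow> (real \<Rightarrow> real^3) \<Rightarrow> (real \<Rightarrow> real^3) \<Rightarrow> (real \<Rightarrow> real^3) \<Rightarrow> bool" where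
  "bertrand_pair I a Na b Nb \<longleftrightarrow> (\<forall>s\<in>I. normal_line (a s) (Na s) = normal_line (b s) (Nb s))"

(* A vector field along the curve is a map defined on I; it is represented by a total function
   whose values outside I are irrelevant, which is the content of the congruence clause. *)
definition bertrand_connection ::
  "real set \<Rightarrow> real \<Rightarrow> (real \<Rightarrow> real^3) \<Rightarrow> (real \<Rightarrow> real^3) \<Rightarrow> (real \<Rightarrow> real^3)
    \<Rightarrow> (real \<Rightarrow> real) \<Rightarrow> (real \<Rightarrow> real) \<Rightarrow> ((real \<Rightarrow> real^3) \<Rightarrow> real \<Rightarrow> real^3) \<Rightarrow> bool" where
  "bertrand_connection I \<theta> T N B k t D \<longleftrightarrow>
     (\<forall>X. smooth_on I X \<longrightarrow> smooth_on I (D X)) \<and>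
     (\<forall>X Y. smooth_on I X \<longrightarrow> smooth_on I Y \<longrightarrow> (\<forall>s\<in>I. X s = Y s) \<longrightarrow> (\<forall>s\<in>I. D X s = D Y s)) \<and>
     (\<forall>X Y. smooth_on I X \<longrightarrow> smooth_on I Y \<longrightarrow>
        (\<forall>s\<in>I. D (\<lambda>u. X u + Y u) s = D X s + D Y s)) \<and>
     (\<forall>f X. smooth_on I f \<longrightarrow> smooth_on I X \<longrightarrow>
        (\<forall>s\<in>I. D (\<lambda>u. f u *\<^sub>R X u) s = ddt I f s *\<^sub>R X s + f s *\<^sub>R D X s)) \<and>
     (\<forall>s\<in>I.
        D T s = ((1 - cos \<theta>) / sin \<theta> * k s) *\<^sub>R N s \<and>
        D N s = - ((1 - cos \<theta>) / sin \<theta> * k s) *\<^sub>R T s + ((1 - cos \<theta>) / sin \<theta> * t s) *\<^sub>R B s \<and>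
        D B s = - ((1 - cos \<theta>) / sin \<theta> * t s) *\<^sub>R N s)"

definition mean_curvature_vector ::
  "(real \<Rightarrow> real) \<Rightarrow> (real \<Rightarrow> real) \<Rightarrow> (real \<Rightarrow> real^3) \<Rightarrow> real \<Rightarrow> real^3" where
  "mean_curvature_vector v k N = (\<lambda>s. (v s * k s) *\<^sub>R N s)"

definition laplacian ::
  "((real \<Rightarrow> real^3) \<Rightarrow> real \<Rightarrow> real^3) \<Rightarrow> (real \<Rightarrow> real^3) \<Rightarrow> real \<Rightarrow> real^3" where
  "laplacian D X = (\<lambda>s. - D (D X) s)"

definition biharmonic ::
  "real set \<Rightarrow> ((real \<Rightarrow> real^3) \<Rightarrow> real \<Rightarrow> real^3) \<Rightarrow> (real \<Rightarrow> real^3) \<Rightarrow> bool" where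
  "biharmonic I D H \<longleftrightarrow> (\<forall>s\<in>I. laplacian D H s = 0)"

definition one_type_harmonic ::
  "real set \<Rightarrow> ((real \<Rightarrow> real^3) \<Rightarrow> real \<Rightarrow> real^3) \<Rightarrow> (real \<Rightarrow> real^3) \<Rightarrow> bool" where
  "one_type_harmonic I D H \<longleftrightarrow> (\<exists>c. \<forall>s\<in>I. laplacian D H s = c *\<^sub>R H s)"

end

theory Submission
  imports Defs
begin

text \<open>
  Comparing \<open>\<beta>' = (1 - \<lambda>\<kappa>) T + \<lambda>\<tau> B\<close> with \<open>\<beta>' = \<vartheta> (cos \<theta> T + sin \<theta> B)\<close> gives \<open>\<lambda> cos \<theta> = \<mu> sin \<theta>\<close>, and
  differentiating \<open>T\<^sub>\<beta>\<close> gives \<open>\<vartheta>\<kappa>\<^sub>\<beta> = \<kappa> cos \<theta> - \<tau> sin \<theta>\<close>; so the mean curvature vector is \<open>h N\<close> with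
  \<open>h = (\<lambda>\<kappa> - sin\<^sup>2 \<theta>) / (\<mu> sin \<theta>)\<close>.  With \<open>q = (1 - cos \<theta>) / sin \<theta> \<noteq> 0\<close>, two applications of \<open>D\<close> give
  \<open>D D (h N) = -q (2 h' \<kappa> + h \<kappa>') T + (h'' - q\<^sup>2 h (\<kappa>\<^sup>2 + \<tau>\<^sup>2)) N + q (2 h' \<tau> + h \<tau>') B\<close>,
  and the three equations are the components of \<open>-D D (h N) = c h N\<close>; the biharmonic case is \<open>c = 0\<close>.
\<close>

section \<open>Derivatives relative to an interval\<close>

text \<open>\<open>vector_derivative\<close> is a choice among derivatives, so computing it requires
  limits within I to be unique. Nonempty interior rules out a one-point interval, and a connected
  set with more than one point has no isolated point.\<close>

lemma at_within_interval_neq_bot: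
  fixes I :: "real set"
  assumes "is_interval I" "interior I \<noteq> {}" "s \<in> I"
  shows "at s within I \<noteq> bot"
proof -
  have "I \<noteq> {s}"
    using assms(2) by (metis interior_singleton)
  then have "s islimpt I"
    using connected_imp_perfect[OF is_interval_connected] assms by blast
  then show ?thesis
    by (simp add: trivial_limit_within)
qed

lemma ddt_eqI:
  assumes "(f has_vector_derivative d) (at s within I)" "at s within I \<noteq> bot"
  shows "ddt I f s = d"
  unfolding ddt_def using assms by (intro vector_derivative_within) auto

lemma ddt_works:
  assumes "f differentiable (at s within I)"
  shows "(f has_vector_derivative ddt I f s) (at s within I)"
  using assms by (simp add: ddt_def vector_derivative_works)

text \<open>Agreement on I makes the two \<open>has_vector_derivative\<close> predicates identical,
  so the choice behind \<open>vector_derivative\<close> returns the same value for both.\<close>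

lemma ddt_cong:
  assumes "\<And>u. u \<in> I \<Longrightarrow> f u = g u" "s \<in> I"
  shows "ddt I f s = ddt I g s"
proof -
  have "(f has_vector_derivative d) (at s within I)
      \<longleftrightarrow> (g has_vector_derivative d) (at s within I)" for d
    using assms by (intro has_vector_derivative_cong_ev) auto
  then show ?thesis
    by (simp add: ddt_def vector_derivative_def)
qed

lemma differentiable_within_cong:
  assumes "\<And>u. u \<in> I \<Longrightarrow> f u = g u" "s \<in> I"
  shows "f differentiable (at s within I) \<longleftrightarrow> g differentiable (at s within I)"
proof -
  have "(f has_derivative d) (at s within I) \<longleftrightarrow> (g has_derivative d) (at s within I)" for d
    using assms by (auto intro: has_derivative_transform[rotated 2])
  then show ?thesis
    by (simp add: differentiable_def)
qed

section \<open>Smoothness of finite order; rules for sums and products\<close>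

text \<open>A finite-order form of \<open>smooth_on\<close> that allows induction on n. Order 0
  already asks for one derivative, so order n means n + 1 successive differentiations.\<close>

definition k_smooth_on :: "real set \<Rightarrow> nat \<Rightarrow> (real \<Rightarrow> 'a::real_normed_vector) \<Rightarrow> bool" where
  "k_smooth_on I n f \<longleftrightarrow> (\<forall>m\<le>n. \<forall>s\<in>I. (ddt I ^^ m) f differentiable (at s within I))"

lemma smooth_on_iff_k_smooth: "smooth_on I f \<longleftrightarrow> (\<forall>n. k_smooth_on I n f)"
  by (auto simp: smooth_on_def k_smooth_on_def)

lemma k_smooth_on_0: "k_smooth_on I 0 f \<longleftrightarrow> (\<forall>s\<in>I. f differentiable (at s within I))"
  by (simp add: k_smooth_on_def)

text \<open>The extra \<open>ddt I\<close> is peeled off next to f rather than on the outside, so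
  that inductions with f arbitrary can apply their hypothesis to \<open>ddt I f\<close>.\<close>

lemma k_smooth_on_Suc:
  "k_smooth_on I (Suc n) f \<longleftrightarrow>
     (\<forall>s\<in>I. f differentiable (at s within I)) \<and> k_smooth_on I n (ddt I f)"
proof -
  have "(\<forall>m\<le>Suc n. P m) \<longleftrightarrow> P 0 \<and> (\<forall>m\<le>n. P (Suc m))" for P
    by (metis Suc_le_mono le0 not0_implies_Suc)
  then show ?thesis
    unfolding k_smooth_on_def by (simp add: funpow_swap1)
qed

lemma k_smooth_on_SucD: "k_smooth_on I (Suc n) f \<Longrightarrow> k_smooth_on I n f"
  by (simp add: k_smooth_on_def)

lemma smooth_on_differentiable:
  "smooth_on I f \<Longrightarrow> s \<in> I \<Longrightarrow> f differentiable (at s within I)"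
  unfolding smooth_on_iff_k_smooth using k_smooth_on_0[of I f] by blast

lemma smooth_on_ddt: "smooth_on I f \<Longrightarrow> smooth_on I (ddt I f)"
  unfolding smooth_on_iff_k_smooth using k_smooth_on_Suc[of I _ f] by simp

text \<open>The sum and product rules describe \<open>ddt I\<close> only at points of I, although it
  yields total functions; this lemma carries smoothness across such identities.\<close>

lemma k_smooth_on_cong:
  "(\<And>u. u \<in> I \<Longrightarrow> f u = g u) \<Longrightarrow> k_smooth_on I n f \<longleftrightarrow> k_smooth_on I n g"
proof (induction n arbitrary: f g)
  case 0
  then show ?case
    using differentiable_within_cong by (metis k_smooth_on_0)
next
  case (Suc n)
  have "k_smooth_on I n (ddt I f) \<longleftrightarrow> k_smooth_on I n (ddt I g)"
    using Suc.prems by (intro Suc.IH ddt_cong) auto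
  with Suc.prems show ?case
    using differentiable_within_cong by (metis k_smooth_on_Suc)
qed

lemma smooth_on_cong:
  "(\<And>u. u \<in> I \<Longrightarrow> f u = g u) \<Longrightarrow> smooth_on I f \<longleftrightarrow> smooth_on I g"
  using k_smooth_on_cong[of I f g] by (simp add: smooth_on_iff_k_smooth)

lemma ddt_const: "at s within I \<noteq> bot \<Longrightarrow> ddt I (\<lambda>_. c) s = 0"
  by (intro ddt_eqI) auto

lemma ddt_add:
  assumes "f differentiable (at s within I)" "g differentiable (at s within I)"
    and "at s within I \<noteq> bot"
  shows "ddt I (\<lambda>u. f u + g u) s = ddt I f s + ddt I g s"
  by (rule ddt_eqI[OF has_vector_derivative_add[OF ddt_works ddt_works]]; fact)

lemma ddt_scaleR:
  fixes f :: "real \<Rightarrow> real"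
  assumes "f differentiable (at s within I)" "g differentiable (at s within I)"
    and "at s within I \<noteq> bot"
  shows "ddt I (\<lambda>u. f u *\<^sub>R g u) s = ddt I f s *\<^sub>R g s + f s *\<^sub>R ddt I g s"
proof -
  have "(f has_field_derivative ddt I f s) (at s within I)"
    using ddt_works[OF assms(1)] by (simp add: has_real_derivative_iff_has_vector_derivative)
  from has_vector_derivative_scaleR[OF this ddt_works[OF assms(2)]] show ?thesis
    using assms(3) by (simp add: ddt_eqI add.commute)
qed

lemma k_smooth_on_add:
  assumes "\<And>s. s \<in> I \<Longrightarrow> at s within I \<noteq> bot"
  shows "k_smooth_on I n f \<Longrightarrow> k_smooth_on I n g \<Longrightarrow> k_smooth_on I n (\<lambda>u. f u + g u)"
proof (induction n arbitrary: f g)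
  case 0
  then show ?case
    by (simp add: k_smooth_on_0)
next
  case (Suc n)
  have "k_smooth_on I n (\<lambda>u. ddt I f u + ddt I g u)"
    using Suc by (simp add: k_smooth_on_Suc)
  moreover have "ddt I (\<lambda>u. f u + g u) s = ddt I f s + ddt I g s" if "s \<in> I" for s
    using Suc.prems assms that by (intro ddt_add) (auto simp: k_smooth_on_Suc)
  ultimately have "k_smooth_on I n (ddt I (\<lambda>u. f u + g u))"
    using k_smooth_on_cong by (metis (mono_tags, lifting))
  then show ?case
    using Suc.prems by (simp add: k_smooth_on_Suc)
qed

lemma k_smooth_on_scaleR:
  fixes f :: "real \<Rightarrow> real"
  assumes "\<And>s. s \<in> I \<Longrightarrow> at s within I \<noteq> bot"
  shows "k_smooth_on I n f \<Longrightarrow> k_smooth_on I n g \<Longrightarrow> k_smooth_on I n (\<lambda>u. f u *\<^sub>R g u)"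
proof (induction n arbitrary: f g)
  case 0
  then show ?case
    by (simp add: k_smooth_on_0)
next
  case (Suc n)
  \<comment> \<open>By the Leibniz rule each summand pairs one factor with the derivative of the
    other. The undifferentiated factor is lowered to order n by
    \<open>k_smooth_on_SucD\<close>.\<close>
  have "k_smooth_on I n (\<lambda>u. ddt I f u *\<^sub>R g u + f u *\<^sub>R ddt I g u)"
    using Suc.prems Suc.prems[THEN k_smooth_on_SucD]
    by (intro k_smooth_on_add assms Suc.IH) (simp_all add: k_smooth_on_Suc)
  moreover have "ddt I (\<lambda>u. f u *\<^sub>R g u) s = ddt I f s *\<^sub>R g s + f s *\<^sub>R ddt I g s" if "s \<in> I" for s
    using Suc.prems assms that by (intro ddt_scaleR) (auto simp: k_smooth_on_Suc)
  ultimately have "k_smooth_on I n (ddt I (\<lambda>u. f u *\<^sub>R g u))"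
    using k_smooth_on_cong by (metis (mono_tags, lifting))
  then show ?case
    using Suc.prems by (simp add: k_smooth_on_Suc)
qed

lemma smooth_on_const:
  assumes "\<And>s. s \<in> I \<Longrightarrow> at s within I \<noteq> bot"
  shows "smooth_on I (\<lambda>_. c)"
proof -
  have "k_smooth_on I n (\<lambda>_. c)" for n
  \<comment> \<open>The constant must vary, since the derivative is the constant 0.\<close>
  proof (induction n arbitrary: c)
    case 0
    then show ?case
      by (simp add: k_smooth_on_0)
  next
    case (Suc n)
    have "k_smooth_on I n (ddt I (\<lambda>_. c)) \<longleftrightarrow> k_smooth_on I n (\<lambda>_. 0 :: 'a)"
      using assms by (intro k_smooth_on_cong ddt_const)
    with Suc[of 0] show ?case
      by (simp add: k_smooth_on_Suc)
  qed
  then show ?thesis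
    by (simp add: smooth_on_iff_k_smooth)
qed

lemma smooth_on_add:
  assumes "\<And>s. s \<in> I \<Longrightarrow> at s within I \<noteq> bot" "smooth_on I f" "smooth_on I g"
  shows "smooth_on I (\<lambda>u. f u + g u)"
  using assms(2,3) by (simp add: smooth_on_iff_k_smooth k_smooth_on_add[OF assms(1)])

lemma smooth_on_scaleR:
  fixes f :: "real \<Rightarrow> real"
  assumes "\<And>s. s \<in> I \<Longrightarrow> at s within I \<noteq> bot" "smooth_on I f" "smooth_on I g"
  shows "smooth_on I (\<lambda>u. f u *\<^sub>R g u)"
  using assms(2,3) by (simp add: smooth_on_iff_k_smooth k_smooth_on_scaleR[OF assms(1)])

lemma smooth_on_mult:
  fixes f g :: "real \<Rightarrow> real"
  assumes "\<And>s. s \<in> I \<Longrightarrow> at s within I \<noteq> bot" "smooth_on I f" "smooth_on I g"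
  shows "smooth_on I (\<lambda>u. f u * g u)"
  using smooth_on_scaleR[OF assms] by simp

lemma ddt_mult:
  fixes f g :: "real \<Rightarrow> real"
  assumes "f differentiable (at s within I)" "g differentiable (at s within I)"
    and "at s within I \<noteq> bot"
  shows "ddt I (\<lambda>u. f u * g u) s = ddt I f s * g s + f s * ddt I g s"
  using ddt_scaleR[OF assms] by simp

lemma ddt_cmult:
  fixes f :: "real \<Rightarrow> real"
  assumes "f differentiable (at s within I)" "at s within I \<noteq> bot"
  shows "ddt I (\<lambda>u. c * f u) s = c * ddt I f s"
  using ddt_mult[OF differentiable_const assms, of c] by (simp add: ddt_const[OF assms(2)])

section \<open>Frame coordinates and the connection applied twice\<close>

text \<open>Inner products with the three frame vectors read off the coefficients; the cross product
  is a unit vector by \<open>norm_cross_dot\<close>. This turns vector equations along the curve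
  into scalar ones.\<close>

lemma orthonormal_frame_eq_iff:
  fixes t n :: "real^3"
  assumes "norm t = 1" "norm n = 1" "t \<bullet> n = 0"
  shows "a *\<^sub>R t + b *\<^sub>R n + c *\<^sub>R cross3 t n = a' *\<^sub>R t + b' *\<^sub>R n + c' *\<^sub>R cross3 t n
    \<longleftrightarrow> a = a' \<and> b = b' \<and> c = c'" (is "?x = ?y \<longleftrightarrow> _")
proof
  assume eq: "?x = ?y"
  have tt: "t \<bullet> t = 1" "n \<bullet> n = 1"
    using assms by (simp_all add: dot_square_norm)
  have "(norm (cross3 t n))\<^sup>2 = 1"
    using norm_cross_dot[of t n] assms by simp
  then have cc: "cross3 t n \<bullet> cross3 t n = 1"
    by (simp add: dot_square_norm)
  have cr: "cross3 t n \<bullet> t = 0" "cross3 t n \<bullet> n = 0" "t \<bullet> cross3 t n = 0" "n \<bullet> cross3 t n = 0"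
    by (simp_all add: dot_cross_self)
  have nt: "n \<bullet> t = 0"
    using assms by (simp add: inner_commute)
  have "?x \<bullet> t = ?y \<bullet> t" "?x \<bullet> n = ?y \<bullet> n" "?x \<bullet> cross3 t n = ?y \<bullet> cross3 t n"
    using eq by simp_all
  then show "a = a' \<and> b = b' \<and> c = c'"
    unfolding inner_add_left inner_scaleR_left by (simp add: tt cc cr nt assms)
qed auto

text \<open>The factor 2 arises because h' meets \<open>D N\<close> once when h' N is differentiated
  and once inside the derivatives of the T and B coefficients. \<open>D T\<close> and
  \<open>D B\<close> return to N and produce the term in \<kappa>^2 + \<tau>^2. H need only agree
  with h N on I, as the mean curvature vector does.\<close>

lemma bertrand_connection_twice_normal:
  fixes I :: "real set" and D :: "(real \<Rightarrow> real^3) \<Rightarrow> real \<Rightarrow> real^3"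
  assumes nb: "\<And>s. s \<in> I \<Longrightarrow> at s within I \<noteq> bot"
    and D: "bertrand_connection I \<theta> T N B k t D"
    and sm: "smooth_on I T" "smooth_on I N" "smooth_on I B"
      "smooth_on I k" "smooth_on I t" "smooth_on I h"
    and H: "smooth_on I H" "\<And>s. s \<in> I \<Longrightarrow> H s = h s *\<^sub>R N s"
    and q: "q = (1 - cos \<theta>) / sin \<theta>"
    and s: "s \<in> I"
  shows "D (D H) s =
    (- q * (2 * ddt I h s * k s + h s * ddt I k s)) *\<^sub>R T s
    + (ddt I (ddt I h) s - q\<^sup>2 * h s * ((k s)\<^sup>2 + (t s)\<^sup>2)) *\<^sub>R N s
    + (q * (2 * ddt I h s * t s + h s * ddt I t s)) *\<^sub>R B s"
proof -
  have Dsm: "smooth_on I (D X)" if "smooth_on I X" for X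
    using D that unfolding bertrand_connection_def by blast
  have Dcong: "D X u = D Y u"
    if "smooth_on I X" "smooth_on I Y" "\<And>s. s \<in> I \<Longrightarrow> X s = Y s" "u \<in> I" for X Y u
    using D that unfolding bertrand_connection_def by blast
  have Dadd: "D (\<lambda>u. X u + Y u) s = D X s + D Y s"
    if "smooth_on I X" "smooth_on I Y" "s \<in> I" for X Y s
    using D that unfolding bertrand_connection_def by blast
  have Dscale: "D (\<lambda>u. f u *\<^sub>R X u) s = ddt I f s *\<^sub>R X s + f s *\<^sub>R D X s"
    if "smooth_on I f" "smooth_on I X" "s \<in> I" for f X s
    using D that unfolding bertrand_connection_def by blast
  have frame: "D T u = (q * k u) *\<^sub>R N u" "D N u = - (q * k u) *\<^sub>R T u + (q * t u) *\<^sub>R B u"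
    "D B u = - (q * t u) *\<^sub>R N u" if "u \<in> I" for u
    using D that unfolding bertrand_connection_def q by auto
  note smI = smooth_on_add smooth_on_scaleR smooth_on_mult smooth_on_const smooth_on_ddt sm
  \<comment> \<open>The T and B components of D(h N), read off from D N = -q k T + q t B.\<close>
  define f where "f = (\<lambda>u. (- q) * (h u * k u))"
  define g where "g = (\<lambda>u. q * (h u * t u))"
  have smfg: "smooth_on I f" "smooth_on I g"
    unfolding f_def g_def by (intro smI nb; assumption)+
  have smhk: "smooth_on I (\<lambda>u. h u * k u)" "smooth_on I (\<lambda>u. h u * t u)"
    by (intro smI nb; assumption)+
  have smh': "smooth_on I (ddt I h)"
    by (intro smI)
  have DH: "D H u = ddt I h u *\<^sub>R N u + (f u *\<^sub>R T u + g u *\<^sub>R B u)" if "u \<in> I" for u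
  proof -
    have "D H u = D (\<lambda>u. h u *\<^sub>R N u) u"
      using that H by (intro Dcong) (auto intro!: smI nb)
    also have "\<dots> = ddt I h u *\<^sub>R N u + h u *\<^sub>R D N u"
      using that by (intro Dscale sm)
    finally show ?thesis
      using that by (simp add: frame f_def g_def algebra_simps)
  qed
  have smFG: "smooth_on I (\<lambda>u. ddt I h u *\<^sub>R N u)" "smooth_on I (\<lambda>u. f u *\<^sub>R T u)"
    "smooth_on I (\<lambda>u. g u *\<^sub>R B u)"
    by (intro smI smfg nb; assumption)+
  have smFG': "smooth_on I (\<lambda>u. f u *\<^sub>R T u + g u *\<^sub>R B u)"
    by (intro smooth_on_add nb smFG)
  have smDH: "smooth_on I (\<lambda>u. ddt I h u *\<^sub>R N u + (f u *\<^sub>R T u + g u *\<^sub>R B u))"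
    by (intro smooth_on_add[OF nb smFG(1) smFG'])
  have "D (D H) s = D (\<lambda>u. ddt I h u *\<^sub>R N u + (f u *\<^sub>R T u + g u *\<^sub>R B u)) s"
    \<comment> \<open>\<open>DH\<close> is an identity on I only, so the congruence clause of the
      connection is what permits applying D to both sides.\<close>
    by (intro Dcong Dsm smDH H(1) s DH)
  also have "\<dots> = (ddt I (ddt I h) s *\<^sub>R N s + ddt I h s *\<^sub>R D N s)
      + ((ddt I f s *\<^sub>R T s + f s *\<^sub>R D T s) + (ddt I g s *\<^sub>R B s + g s *\<^sub>R D B s))"
    by (simp only: Dadd[OF smFG(1) smFG' s] Dadd[OF smFG(2,3) s] Dscale[OF smh' sm(2) s]
        Dscale[OF smfg(1) sm(1) s] Dscale[OF smfg(2) sm(3) s])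
  finally have *: "D (D H) s = \<dots>" .
  note diff = smooth_on_differentiable[OF _ s]
  have f': "ddt I f s = - q * (ddt I h s * k s + h s * ddt I k s)"
    unfolding f_def ddt_cmult[OF diff[OF smhk(1)] nb[OF s]]
      ddt_mult[OF diff[OF sm(6)] diff[OF sm(4)] nb[OF s]] ..
  have g': "ddt I g s = q * (ddt I h s * t s + h s * ddt I t s)"
    unfolding g_def ddt_cmult[OF diff[OF smhk(2)] nb[OF s]]
      ddt_mult[OF diff[OF sm(6)] diff[OF sm(5)] nb[OF s]] ..
  show ?thesis
    unfolding * frame[OF s] f' g' by (simp add: vec_eq_iff f_def g_def algebra_simps power2_eq_square)
qed

section \<open>The mean curvature vector of the partner and the harmonicity equations\<close>

theorem theorem2p3:
  fixes I :: "real set"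
    and \<alpha> T N B \<beta> T\<^sub>\<beta> N\<^sub>\<beta> B\<^sub>\<beta> :: "real \<Rightarrow> real^3"
    and \<kappa> \<tau> v\<^sub>\<beta> \<kappa>\<^sub>\<beta> \<tau>\<^sub>\<beta> :: "real \<Rightarrow> real"
    and l \<mu> \<theta> :: real
    and D :: "(real \<Rightarrow> real^3) \<Rightarrow> real \<Rightarrow> real^3"
  assumes "is_interval I" and "interior I \<noteq> {}"
    and "frenet_curve I \<alpha> (\<lambda>_. 1) T N B \<kappa> \<tau>"
    and "\<forall>s\<in>I. \<kappa> s > 0 \<and> \<tau> s > 0"
    and "frenet_curve I \<beta> v\<^sub>\<beta> T\<^sub>\<beta> N\<^sub>\<beta> B\<^sub>\<beta> \<kappa>\<^sub>\<beta> \<tau>\<^sub>\<beta>"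
    and "bertrand_pair I \<alpha> N \<beta> N\<^sub>\<beta>"
    and "\<forall>s\<in>I. \<beta> s = \<alpha> s + l *\<^sub>R N s"
    and "\<forall>s\<in>I. l * \<kappa> s + \<mu> * \<tau> s = 1"
    and "l \<noteq> 0" and "\<mu> \<noteq> 0"
    and "\<forall>s\<in>I. T\<^sub>\<beta> s = cos \<theta> *\<^sub>R T s + sin \<theta> *\<^sub>R B s"
    and "\<forall>s\<in>I. N\<^sub>\<beta> s = N s"
    and "sin \<theta> \<noteq> 0"
    and "bertrand_connection I \<theta> T N B \<kappa> \<tau> D"
  shows "(biharmonic I D (mean_curvature_vector v\<^sub>\<beta> \<kappa>\<^sub>\<beta> N\<^sub>\<beta>) \<longleftrightarrow>
     (\<forall>s\<in>I.
        (3 * l * \<kappa> s - (sin \<theta>)\<^sup>2) * ddt I \<kappa> s = 0 \<and>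
        (l * \<kappa> s - (sin \<theta>)\<^sup>2) * (1 - cos \<theta>)\<^sup>2 * ((\<kappa> s)\<^sup>2 + (\<tau> s)\<^sup>2)
          - l * ddt I (ddt I \<kappa>) s * (sin \<theta>)\<^sup>2 = 0 \<and>
        (sin \<theta>)\<^sup>2 * ddt I \<tau> s - l * \<kappa> s * ddt I \<tau> s - 2 * l * ddt I \<kappa> s * \<tau> s = 0)) \<and>
    (one_type_harmonic I D (mean_curvature_vector v\<^sub>\<beta> \<kappa>\<^sub>\<beta> N\<^sub>\<beta>) \<longleftrightarrow>
     (\<exists>c::real. \<forall>s\<in>I.
        (3 * l * \<kappa> s - (sin \<theta>)\<^sup>2) * ddt I \<kappa> s = 0 \<and>
        ((l * \<kappa> s - (sin \<theta>)\<^sup>2) * (1 - cos \<theta>)\<^sup>2 * ((\<kappa> s)\<^sup>2 + (\<tau> s)\<^sup>2)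
          - l * ddt I (ddt I \<kappa>) s * (sin \<theta>)\<^sup>2) / (sin \<theta>)\<^sup>2
          = c * (l * \<kappa> s - (sin \<theta>)\<^sup>2) \<and>
        (sin \<theta>)\<^sup>2 * ddt I \<tau> s - l * \<kappa> s * ddt I \<tau> s - 2 * l * ddt I \<kappa> s * \<tau> s = 0))"
proof -
  note I = assms(1,2) and al = assms(3) and be = assms(5) and beta = assms(7) and lm = assms(8)
    and Tb = assms(11) and Nb = assms(12) and sin0 = assms(13)
  have nb: "at s within I \<noteq> bot" if "s \<in> I" for s
    using at_within_interval_neq_bot[OF I that] .
  have sm: "smooth_on I \<alpha>" "smooth_on I T" "smooth_on I N" "smooth_on I B"
    "smooth_on I \<kappa>" "smooth_on I \<tau>"
    using al by (auto simp: frenet_curve_def)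
  have fr: "norm (T s) = 1" "norm (N s) = 1" "T s \<bullet> N s = 0" "B s = cross3 (T s) (N s)"
    and da: "ddt I \<alpha> s = T s" "ddt I T s = \<kappa> s *\<^sub>R N s" "ddt I N s = - \<kappa> s *\<^sub>R T s + \<tau> s *\<^sub>R B s"
      "ddt I B s = - \<tau> s *\<^sub>R N s"
    and db: "ddt I \<beta> s = v\<^sub>\<beta> s *\<^sub>R T\<^sub>\<beta> s" "ddt I T\<^sub>\<beta> s = (v\<^sub>\<beta> s * \<kappa>\<^sub>\<beta> s) *\<^sub>R N\<^sub>\<beta> s"
    if "s \<in> I" for s
    using al be that by (auto simp: frenet_curve_def)
  have uniq: "a *\<^sub>R T s + b *\<^sub>R N s + c *\<^sub>R B s = a' *\<^sub>R T s + b' *\<^sub>R N s + c' *\<^sub>R B s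
      \<longleftrightarrow> a = a' \<and> b = b' \<and> c = c'" if "s \<in> I" for s a b c a' b' c'
    using orthonormal_frame_eq_iff[OF fr(1-3)[OF that]] fr(4)[OF that] by simp
  note diff = smooth_on_differentiable
  \<comment> \<open>Coefficients of h as an affine function of \<kappa>, so that h' and h'' are just
    a \<kappa>' and a \<kappa>''.\<close>
  define a where "a = l / (\<mu> * sin \<theta>)"
  define b where "b = - sin \<theta> / \<mu>"
  define h where "h = (\<lambda>s. a * \<kappa> s + b)"
  have h_alt: "h s = (l * \<kappa> s - (sin \<theta>)\<^sup>2) / (\<mu> * sin \<theta>)" for s
    using sin0 assms(10) by (simp add: h_def a_def b_def field_simps power2_eq_square)
  have vk: "v\<^sub>\<beta> s * \<kappa>\<^sub>\<beta> s = h s" if s: "s \<in> I" for s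
  proof -
    have "ddt I \<beta> s = ddt I (\<lambda>u. \<alpha> u + l *\<^sub>R N u) s"
      using beta s by (intro ddt_cong) auto
    also have "\<dots> = ddt I \<alpha> s + l *\<^sub>R ddt I N s"
      using diff[OF sm(1) s] diff[OF sm(3) s] nb[OF s] by (simp add: ddt_add ddt_scaleR ddt_const)
    finally have "(v\<^sub>\<beta> s * cos \<theta>) *\<^sub>R T s + 0 *\<^sub>R N s + (v\<^sub>\<beta> s * sin \<theta>) *\<^sub>R B s
        = (1 - l * \<kappa> s) *\<^sub>R T s + 0 *\<^sub>R N s + (l * \<tau> s) *\<^sub>R B s"
      using Tb s by (simp add: da db algebra_simps)
    then have "v\<^sub>\<beta> s * cos \<theta> = 1 - l * \<kappa> s" "v\<^sub>\<beta> s * sin \<theta> = l * \<tau> s"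
      using uniq[OF s] by blast+
    moreover have mt: "1 - l * \<kappa> s = \<mu> * \<tau> s"
      using lm s by (simp add: algebra_simps)
    \<comment> \<open>Eliminates the speed: both sides equal
      \<open>v\<^sub>\<beta> s * sin \<theta> * cos \<theta>\<close>. Then \<tau> > 0 is
      cancelled.\<close>
    ultimately have "\<tau> s * (l * cos \<theta>) = \<tau> s * (\<mu> * sin \<theta>)"
      by algebra
    then have ang: "l * cos \<theta> = \<mu> * sin \<theta>"
      using assms(4) s by force
    have "ddt I T\<^sub>\<beta> s = ddt I (\<lambda>u. cos \<theta> *\<^sub>R T u + sin \<theta> *\<^sub>R B u) s"
      using Tb s by (intro ddt_cong) auto
    also have "\<dots> = cos \<theta> *\<^sub>R ddt I T s + sin \<theta> *\<^sub>R ddt I B s"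
      using diff[OF sm(2) s] diff[OF sm(4) s] nb[OF s] by (simp add: ddt_add ddt_scaleR ddt_const)
    finally have "(v\<^sub>\<beta> s * \<kappa>\<^sub>\<beta> s) *\<^sub>R N s = (\<kappa> s * cos \<theta> - \<tau> s * sin \<theta>) *\<^sub>R N s"
      using Nb s by (simp add: da db algebra_simps)
    then have "v\<^sub>\<beta> s * \<kappa>\<^sub>\<beta> s = \<kappa> s * cos \<theta> - \<tau> s * sin \<theta>"
      using fr(2)[OF s] by auto
    \<comment> \<open>Substituting \<mu> sin \<theta> = l cos \<theta> in the first term and \<mu>
      \<tau> = 1 - l \<kappa> in the second leaves l \<kappa> cos^2 \<theta> - (1 - l \<kappa>)
      sin^2 \<theta>.\<close>
    moreover have "(\<kappa> s * cos \<theta> - \<tau> s * sin \<theta>) * (\<mu> * sin \<theta>) = l * \<kappa> s - (sin \<theta>)\<^sup>2"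
      using ang mt sin_cos_squared_add[of \<theta>] by algebra
    ultimately show ?thesis
      using sin0 assms(10) by (simp add: h_alt nonzero_eq_divide_eq)
  qed
  define H where "H = mean_curvature_vector v\<^sub>\<beta> \<kappa>\<^sub>\<beta> N\<^sub>\<beta>"
  have H: "H s = h s *\<^sub>R N s" if "s \<in> I" for s
    using that vk Nb by (simp add: H_def mean_curvature_vector_def)
  have sma: "smooth_on I (\<lambda>u. a * \<kappa> u)"
    by (intro smooth_on_mult smooth_on_const nb sm)
  have smh: "smooth_on I h"
    unfolding h_def by (intro smooth_on_add smooth_on_const nb sma)
  have "smooth_on I (\<lambda>s. h s *\<^sub>R N s)"
    by (intro smooth_on_scaleR nb smh sm)
  then have smH: "smooth_on I H"
    using smooth_on_cong[where f = H, OF H] by simp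
  have h': "ddt I h s = a * ddt I \<kappa> s" if s: "s \<in> I" for s
  proof -
    have "ddt I h s = ddt I (\<lambda>u. a * \<kappa> u) s + ddt I (\<lambda>_. b) s"
      unfolding h_def by (rule ddt_add[OF diff[OF sma s] differentiable_const nb[OF s]])
    then show ?thesis
      using ddt_cmult[OF diff[OF sm(5) s] nb[OF s]] ddt_const[OF nb[OF s], of b] by simp
  qed
  have h'': "ddt I (ddt I h) s = a * ddt I (ddt I \<kappa>) s" if s: "s \<in> I" for s
  proof -
    have "ddt I (ddt I h) s = ddt I (\<lambda>u. a * ddt I \<kappa> u) s"
      by (rule ddt_cong[OF h' s])
    then show ?thesis
      using diff[OF smooth_on_ddt[OF sm(5)] s] nb[OF s] by (simp add: ddt_cmult)
  qed
  define q where "q = (1 - cos \<theta>) / sin \<theta>"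
  \<comment> \<open>Needed for q to be nonzero; the T and B components carry a factor q that has to
    be cancelled.\<close>
  have "cos \<theta> \<noteq> 1"
    using sin0 cos_one_sin_zero by blast
  then have q0: "q \<noteq> 0"
    using sin0 by (simp add: q_def)
  have qs: "q\<^sup>2 * (sin \<theta>)\<^sup>2 = (1 - cos \<theta>)\<^sup>2"
    using sin0 by (simp add: q_def power_divide)
  \<comment> \<open>Stated pointwise and for every c, so that one equivalence serves both parts of
    the theorem.\<close>
  have key: "laplacian D H s = c *\<^sub>R H s \<longleftrightarrow>
        (3 * l * \<kappa> s - (sin \<theta>)\<^sup>2) * ddt I \<kappa> s = 0 \<and>
        ((l * \<kappa> s - (sin \<theta>)\<^sup>2) * (1 - cos \<theta>)\<^sup>2 * ((\<kappa> s)\<^sup>2 + (\<tau> s)\<^sup>2)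
          - l * ddt I (ddt I \<kappa>) s * (sin \<theta>)\<^sup>2) / (sin \<theta>)\<^sup>2
          = c * (l * \<kappa> s - (sin \<theta>)\<^sup>2) \<and>
        (sin \<theta>)\<^sup>2 * ddt I \<tau> s - l * \<kappa> s * ddt I \<tau> s - 2 * l * ddt I \<kappa> s * \<tau> s = 0"
    (is "_ \<longleftrightarrow> ?E1 = 0 \<and> ?E2 = c * ?F \<and> ?E3 = 0") if s: "s \<in> I" for s c
  proof -
    let ?m = "\<mu> * sin \<theta>"
    have m0: "?m \<noteq> 0"
      using sin0 assms(10) by simp
    \<comment> \<open>The coefficient 3 is 2 + 1: 2 h' \<kappa> contributes 2 l \<kappa> \<kappa>',
      and h \<kappa>' contributes (l \<kappa> - sin^2 \<theta>) \<kappa>', both over \<mu> sin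
      \<theta>.\<close>
    have tan: "q * (2 * ddt I h s * \<kappa> s + h s * ddt I \<kappa> s) = q / ?m * ?E1"
      unfolding h'[OF s] h_alt a_def using m0 by (simp add: field_simps)
    \<comment> \<open>The minus sign of the Laplacian is kept here, which gives the third equation
      with its stated signs.\<close>
    have bin: "- q * (2 * ddt I h s * \<tau> s + h s * ddt I \<tau> s) = q / ?m * ?E3"
      unfolding h'[OF s] h_alt a_def using m0 by (simp add: field_simps)
    have E2: "?E2 = q\<^sup>2 * ?F * ((\<kappa> s)\<^sup>2 + (\<tau> s)\<^sup>2) - l * ddt I (ddt I \<kappa>) s"
      using sin0 by (simp add: qs[symmetric] field_simps)
    have nor: "q\<^sup>2 * h s * ((\<kappa> s)\<^sup>2 + (\<tau> s)\<^sup>2) - ddt I (ddt I h) s = ?E2 / ?m"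
      unfolding h''[OF s] h_alt a_def E2 using m0 by (simp add: field_simps)
    have "laplacian D H s = - D (D H) s"
      by (simp add: laplacian_def)
    also have "\<dots> = (q * (2 * ddt I h s * \<kappa> s + h s * ddt I \<kappa> s)) *\<^sub>R T s
        + (q\<^sup>2 * h s * ((\<kappa> s)\<^sup>2 + (\<tau> s)\<^sup>2) - ddt I (ddt I h) s) *\<^sub>R N s
        + (- q * (2 * ddt I h s * \<tau> s + h s * ddt I \<tau> s)) *\<^sub>R B s"
      using bertrand_connection_twice_normal[OF _ assms(14) sm(2-6) smh smH H q_def s] nb
      by (simp add: algebra_simps)
    also have "\<dots> = (q / ?m * ?E1) *\<^sub>R T s + (?E2 / ?m) *\<^sub>R N s + (q / ?m * ?E3) *\<^sub>R B s"
      by (simp only: tan bin nor)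
    finally have "laplacian D H s = c *\<^sub>R H s \<longleftrightarrow>
        (q / ?m * ?E1) *\<^sub>R T s + (?E2 / ?m) *\<^sub>R N s + (q / ?m * ?E3) *\<^sub>R B s
        = 0 *\<^sub>R T s + (c * ?F / ?m) *\<^sub>R N s + 0 *\<^sub>R B s"
      by (simp add: H[OF s] h_alt)
    also have "\<dots> \<longleftrightarrow> q / ?m * ?E1 = 0 \<and> ?E2 / ?m = c * ?F / ?m \<and> q / ?m * ?E3 = 0"
      by (rule uniq[OF s])
    also have "\<dots> \<longleftrightarrow> ?E1 = 0 \<and> ?E2 = c * ?F \<and> ?E3 = 0"
    proof -
      have "q / ?m \<noteq> 0"
        using q0 m0 by simp
      then show ?thesis
        using m0 by (metis divide_cancel_right mult_eq_0_iff)
    qed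
    finally show ?thesis .
  qed
  have "biharmonic I D H \<longleftrightarrow> (\<forall>s\<in>I. laplacian D H s = 0 *\<^sub>R H s)"
    by (simp add: biharmonic_def)
  \<comment> \<open>For c = 0 this removes the denominator, which the biharmonic normal equation
    does not have.\<close>
  moreover have "x / (sin \<theta>)\<^sup>2 = 0 * y \<longleftrightarrow> x = 0" for x y
    using sin0 by simp
  ultimately show ?thesis
    unfolding H_def[symmetric] one_type_harmonic_def by (simp only: key cong: ball_cong)
qed

end
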